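(* Let $K$ be a field, $P=\{p_1,\dots,p_n\}$ a finite poset, and $r$ a positive integer. Then the generalized Hibi ring $R_r(P)$ is an algebra with straightening laws (ASL) on the poset $\mathcal{I}_r(P)$ over $K$ (with respect to the map $\mathcal{I}_r(P)\to R_r(P)$, $\mathcal{I}\mapsto u_{\mathcal{I}}$).
   Context: An order ideal of $P$ is a subset $I$ with $y\leq x\in I\Rightarrow y\in I$. An $r$-multichain in $P$ is a chain of order ideals $\mathcal{I}: I_1\subseteq I_2\subseteq\cdots\subseteq I_{r-1}\subseteq I_r=P$. The set $\mathcal{I}_r(P)$ of all $r$-multichains is partially ordered by componentwise inclusion, and is a distributive lattice under componentwise union and intersection. To $\mathcal{I}\in\mathcal{I}_r(P)$ one associates the monomial $u_{\mathcal{I}}=\prod_{k=1}^r\prod_{p_\ell\in I_k\setminus I_{k-1}}x_{k\ell}$ (with $I_0=\emptyset$) in $S=K[x_{ij}:1\leq i\leq r,1\leq j\leq n]$. The generalized Hibi ring $R_r(P)$ is the $K$-subalgebra of $S$ generated by all $u_{\mathcal{I}}$, $\mathcal{I}\in\mathcal{I}_r(P)$. Let $A$ be a $K$-algebra, $H$ a finite poset, $\varphi:H\to A$ an injective map; identify $\alpha\in H$ with $\varphi(\alpha)$. A standard monomial is a product $\alpha_1\cdots\alpha_k$ with $\alpha_1\leq\cdots\leq\alpha_k$ in $H$. $A$ is an ASL on $H$ over $K$ if: (ASL-1) the standard monomials form a $K$-basis of $A$; (ASL-2) if $\alpha,\beta\in H$ are incomparable and $\alpha\beta=\sum_i r_i\gamma_{i1}\cdots\gamma_{ik_i}$,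 with $0\neq r_i\in K$ and $\gamma_{i1}\leq\cdots\leq\gamma_{ik_i}$, is the unique expression of $\alpha\beta$ as a linear combination of standard monomials, then $\gamma_{i1}\leq\alpha$ and $\gamma_{i1}\leq\beta$ for all $i$. *)

theory Defs
  imports Complex_Main "HOL-Library.Poly_Mapping"
begin

section \<open>Algebras with straightening laws\<close>

text \<open>
  A commutative algebra over a field is a commutative ring with a compatible scalar
  multiplication; the algebras of interest are subalgebras \<open>A\<close> of such a ring.
\<close>

locale algebra_over = vector_space scale
  for scale :: "'k::field \<Rightarrow> 'b::comm_ring_1 \<Rightarrow> 'b" (infixr "*s" 75) +
  assumes scale_mult_left: "(c *s x) * y = c *s (x * y)"
begin

definition subalgebra :: "'b set \<Rightarrow> bool" where
  "subalgebra A \<longleftrightarrow> subspace A \<and> 1 \<in> A \<and> (\<forall>x\<in>A. \<forall>y\<in>A. x * y \<in> A)"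

definition generated_subalgebra :: "'b set \<Rightarrow> 'b set" where
  "generated_subalgebra G = subalgebra hull G"

end

text \<open>
  Standard monomials are indexed by the weakly increasing lists over the poset \<open>H\<close>, the empty
  list giving the monomial \<open>1\<close>.  By antisymmetry such a list is determined by the
  multiset of its entries.
\<close>

definition standard_words :: "'h::order set \<Rightarrow> 'h list set" where
  "standard_words H = {w. set w \<subseteq> H \<and> sorted_wrt (\<le>) w}"

definition word_monomial :: "('h \<Rightarrow> 'b::comm_ring_1) \<Rightarrow> 'h list \<Rightarrow> 'b" where
  "word_monomial \<phi> w = prod_list (map \<phi> w)"

text \<open>
  In \<open>ASL1\<close> the standard monomials are a basis as a family: distinct standard words have
  distinct monomials, and these monomials are linearly independent and span \<open>A\<close>.
  In \<open>ASL2\<close> the function \<open>c\<close> on the finite set \<open>W\<close> is the (by \<open>ASL1\<close> existing and unique)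
  expression of the product with nonzero coefficients.  Since every term is required to have
  a first factor, the empty word may not occur in it.
\<close>

locale ASL = algebra_over scale
  for scale :: "'k::field \<Rightarrow> 'b::comm_ring_1 \<Rightarrow> 'b" (infixr "*s" 75) +
  fixes A :: "'b set" and H :: "'h::order set" and \<phi> :: "'h \<Rightarrow> 'b"
  assumes subalgebra_A: "subalgebra A"
    and finite_H: "finite H"
    and phi_into: "\<phi> ` H \<subseteq> A"
    and phi_inj: "inj_on \<phi> H"
    and ASL1: "inj_on (word_monomial \<phi>) (standard_words H)"
      "independent (word_monomial \<phi> ` standard_words H)"
      "span (word_monomial \<phi> ` standard_words H) = A"
    and ASL2: "\<And>\<alpha> \<beta> W c w.
      \<lbrakk> \<alpha> \<in> H; \<beta> \<in> H; \<not> \<alpha> \<le> \<beta>; \<not> \<beta> \<le> \<alpha>;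
        finite W; W \<subseteq> standard_words H; \<forall>v\<in>W. c v \<noteq> 0;
        \<phi> \<alpha> * \<phi> \<beta> = (\<Sum>v\<in>W. c v *s word_monomial \<phi> v);
        w \<in> W \<rbrakk>
      \<Longrightarrow> w \<noteq> [] \<and> hd w \<le> \<alpha> \<and> hd w \<le> \<beta>"


section \<open>Multichains of order ideals\<close>

definition order_ideal :: "'a::order set \<Rightarrow> 'a set \<Rightarrow> bool" where
  "order_ideal P I \<longleftrightarrow> I \<subseteq> P \<and> (\<forall>x\<in>I. \<forall>y\<in>P. y \<le> x \<longrightarrow> y \<in> I)"

text \<open>
  A multichain \<open>I\<^sub>1 \<subseteq> \<dots> \<subseteq> I\<^sub>r = P\<close> is encoded as a function on all of \<open>nat\<close>, made
  unique by \<open>I\<^sub>0 = {}\<close> and by \<open>I\<^sub>k = P\<close> for \<open>k > r\<close>.  The pointwise order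
  on functions is then exactly componentwise inclusion.
\<close>

definition multichains :: "nat \<Rightarrow> 'a::order set \<Rightarrow> (nat \<Rightarrow> 'a set) set" where
  "multichains r P = {I. (\<forall>k\<in>{1..r}. order_ideal P (I k)) \<and>
     (\<forall>k\<in>{1..<r}. I k \<subseteq> I (Suc k)) \<and> I r = P \<and>
     I 0 = {} \<and> (\<forall>k>r. I k = P)}"


section \<open>Generalized Hibi rings\<close>

text \<open>
  Polynomials in variables \<open>x\<^sub>i\<^sub>j\<close> indexed by pairs of natural numbers, as finitely supported
  functions from exponent vectors to coefficients.  Only the variables with \<open>1 \<le> i \<le> r\<close> and
  \<open>1 \<le> j \<le> n\<close> are used; the subalgebra generated by polynomials in these is the same in
  the larger polynomial ring.
\<close>

type_synonym 'k xpoly = "(nat \<times> nat \<Rightarrow>\<^sub>0 nat) \<Rightarrow>\<^sub>0 'k"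

definition xvar :: "nat \<Rightarrow> nat \<Rightarrow> 'k::field xpoly" where
  "xvar i j = Poly_Mapping.single (Poly_Mapping.single (i, j) 1) 1"

definition xscale :: "'k::field \<Rightarrow> 'k xpoly \<Rightarrow> 'k xpoly" where
  "xscale c f = Poly_Mapping.single 0 c * f"

interpretation xpoly: algebra_over xscale
  by unfold_locales
    (simp_all add: xscale_def distrib_left distrib_right single_add mult_single flip: mult.assoc)

definition hibi_monomial :: "nat \<Rightarrow> nat \<Rightarrow> (nat \<Rightarrow> 'a) \<Rightarrow> (nat \<Rightarrow> 'a set) \<Rightarrow> 'k::field xpoly" where
  "hibi_monomial r n p I =
     (\<Prod>k\<in>{1..r}. \<Prod>l\<in>{l\<in>{1..n}. p l \<in> I k - I (k - 1)}. xvar k l)"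

text \<open>Here \<open>p 1, \<dots>, p n\<close> is an enumeration of \<open>P\<close>.\<close>

definition hibi_ring :: "nat \<Rightarrow> nat \<Rightarrow> (nat \<Rightarrow> 'a::order) \<Rightarrow> 'a set \<Rightarrow> 'k::field xpoly set" where
  "hibi_ring r n p P = xpoly.generated_subalgebra (hibi_monomial r n p ` multichains r P)"

end

theory Submission
  imports Defs
begin

text \<open>
  For a word \<open>w\<close> of multichains let \<open>N\<^sub>k(x)\<close> be the number of letters \<open>I\<close> of \<open>w\<close> with
  \<open>x \<in> I\<^sub>k\<close>.  The exponent of \<open>x\<^sub>k\<^sub>l\<close> in the monomial of \<open>w\<close> is
  \<open>N\<^sub>k(p\<^sub>l) - N\<^sub>k\<^sub>-\<^sub>1(p\<^sub>l)\<close>, so the monomial and the function \<open>N\<close> determine each other.  In an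
  increasing word of length \<open>m\<close> the letters whose \<open>k\<close>-th ideal contains \<open>x\<close> are the last
  \<open>N\<^sub>k(x)\<close> ones, so an increasing word is determined by its monomial.  Conversely, for an
  arbitrary word the sets \<open>{x. N\<^sub>k(x) \<ge> m - a}\<close>, for \<open>a < m\<close>, are the letters of an increasing
  word with the same \<open>N\<close>.  Hence every product of generators is a standard monomial, and
  distinct standard words give distinct monomials of the polynomial ring, which are linearly
  independent.  Finally, the first letter of the standard word for \<open>u\<^sub>\<alpha> u\<^sub>\<beta>\<close> consists of the
  \<open>x\<close> with \<open>N\<^sub>k(x) = 2\<close>, that is, it is \<open>\<alpha> \<inter> \<beta>\<close>.
\<close>

section \<open>Generated subalgebras as spans of words\<close>

lemma word_monomial_append:
  "word_monomial \<phi> (v @ w) = word_monomial \<phi> v * word_monomial \<phi> w"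
  by (simp add: word_monomial_def)

context algebra_over
begin

lemma scale_mult_right: "x * (c *s y) = c *s (x * y)"
  by (metis mult.commute scale_mult_left)

lemma subalgebra_generated: "subalgebra (generated_subalgebra G)"
  unfolding generated_subalgebra_def
  by (rule hull_in) (auto simp: subalgebra_def intro: subspace_Inter)

lemma word_monomial_in_subalgebra:
  assumes "subalgebra A" "\<phi> ` set w \<subseteq> A"
  shows "word_monomial \<phi> w \<in> A"
  using assms by (induction w) (auto simp: subalgebra_def word_monomial_def)

text \<open>Concatenating words multiplies their monomials, so closure under products follows by
  bilinearity: span induction on one factor, then on the other.\<close>

lemma subalgebra_span_words: "subalgebra (span (word_monomial \<phi> ` lists H))"
proof -
  let ?W = "word_monomial \<phi> ` lists H"
  have word: "x * y \<in> span ?W" if "x \<in> ?W" "y \<in> span ?W" for x y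
    using that(2)
  proof (induction rule: span_induct_alt)
    case base
    then show ?case by (simp add: span_zero)
  next
    case (step c z y)
    obtain v w where "x = word_monomial \<phi> v" "v \<in> lists H" "z = word_monomial \<phi> w" "w \<in> lists H"
      using \<open>x \<in> ?W\<close> \<open>z \<in> ?W\<close> by blast
    then have "x * z \<in> ?W"
      by (intro image_eqI[of _ _ "v @ w"]) (simp_all add: word_monomial_append)
    then show ?case
      using step by (simp add: distrib_left scale_mult_right span_add span_scale span_base)
  qed
  have "x * y \<in> span ?W" if "x \<in> span ?W" "y \<in> span ?W" for x y
    using that(1)
  proof (induction rule: span_induct_alt)
    case base
    then show ?case by (simp add: span_zero)
  next
    case (step c z x)
    then show ?case
      using word[OF _ that(2)] by (simp add: distrib_right scale_mult_left span_add span_scale)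
  qed
  moreover have "1 \<in> span ?W"
    by (rule span_base, rule image_eqI[of _ _ "[]"]) (simp_all add: word_monomial_def)
  ultimately show ?thesis
    by (simp add: subalgebra_def)
qed

text \<open>Reduces the spanning half of \<open>ASL1\<close> to a comparison of arbitrary words with
  standard ones.\<close>

lemma generated_subalgebra_eq_span_words:
  "generated_subalgebra (\<phi> ` H) = span (word_monomial \<phi> ` lists H)"
proof
  have "\<phi> h \<in> word_monomial \<phi> ` lists H" if "h \<in> H" for h
    using that by (intro image_eqI[of _ _ "[h]"]) (simp_all add: word_monomial_def)
  then have "\<phi> ` H \<subseteq> span (word_monomial \<phi> ` lists H)"
    by (auto intro: span_base)
  then show "generated_subalgebra (\<phi> ` H) \<subseteq> span (word_monomial \<phi> ` lists H)"
    unfolding generated_subalgebra_def by (intro hull_minimal subalgebra_span_words)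
next
  have "\<phi> ` H \<subseteq> generated_subalgebra (\<phi> ` H)"
    by (simp add: generated_subalgebra_def hull_subset)
  then have "word_monomial \<phi> ` lists H \<subseteq> generated_subalgebra (\<phi> ` H)"
    by (auto intro!: word_monomial_in_subalgebra[OF subalgebra_generated])
  then show "span (word_monomial \<phi> ` lists H) \<subseteq> generated_subalgebra (\<phi> ` H)"
    using subalgebra_generated by (intro span_minimal) (auto simp: subalgebra_def)
qed

end


section \<open>Coefficients and independence of monomials\<close>

lemma xscale_single: "xscale c (Poly_Mapping.single e b) = Poly_Mapping.single e (c * b)"
  by (simp add: xscale_def mult_single)

lemma single_one_eqD:
  assumes "Poly_Mapping.single d (1::'k::zero_neq_one) = Poly_Mapping.single e 1"
  shows "d = e"
  using arg_cong[OF assms, of Poly_Mapping.keys] by simp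

text \<open>By injectivity of \<open>e\<close> only the summand \<open>v = w\<close> meets the
  exponent \<open>e w\<close>. This gives both linear independence and the coefficients in
  \<open>ASL2\<close>.\<close>

lemma lookup_sum_monomials:
  assumes "finite W" "inj_on e W" "w \<in> W"
  shows "Poly_Mapping.lookup (\<Sum>v\<in>W. xscale (c v) (Poly_Mapping.single (e v) 1)) (e w) = c w"
proof -
  have "Poly_Mapping.lookup (\<Sum>v\<in>W. xscale (c v) (Poly_Mapping.single (e v) 1)) (e w)
      = (\<Sum>v\<in>W. if v = w then c v else 0)"
    using assms by (auto simp: lookup_sum xscale_single lookup_single when_def inj_on_eq_iff
        intro!: sum.cong)
  then show ?thesis
    using assms by simp
qed

lemma independent_monomials:
  "xpoly.independent ((\<lambda>e. Poly_Mapping.single e (1::'k::field)) ` E)"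
proof
  assume "xpoly.dependent ((\<lambda>e. Poly_Mapping.single e (1::'k)) ` E)"
  then obtain t u f where t: "finite t" "t \<subseteq> (\<lambda>e. Poly_Mapping.single e (1::'k)) ` E"
    and sum0: "(\<Sum>v\<in>t. xscale (u v) v) = 0" and f: "f \<in> t" "u f \<noteq> 0"
    unfolding xpoly.dependent_explicit by blast
  \<comment> \<open>Choosing one exponent per element of \<open>t\<close> lets the relation be
    reindexed as a sum over exponents.\<close>
  obtain D where inj: "inj_on (\<lambda>e. Poly_Mapping.single e (1::'k)) D"
    and t_eq: "t = (\<lambda>e. Poly_Mapping.single e 1) ` D"
    using t(2) by (meson subset_image_inj)
  have "finite D"
    using t(1) inj by (simp add: t_eq finite_image_iff)
  moreover have "(\<Sum>e\<in>D. xscale (u (Poly_Mapping.single e 1)) (Poly_Mapping.single e 1)) = 0"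
    using sum0 inj by (simp add: t_eq sum.reindex)
  ultimately have "u (Poly_Mapping.single e 1) = 0" if "e \<in> D" for e
    using lookup_sum_monomials[of D "\<lambda>e. e" e "\<lambda>e. u (Poly_Mapping.single e 1)"] that
    by simp
  then show False
    using f by (auto simp: t_eq)
qed


section \<open>Exponent vectors of words\<close>

definition hibi_exponent ::
  "nat \<Rightarrow> nat \<Rightarrow> (nat \<Rightarrow> 'a) \<Rightarrow> (nat \<Rightarrow> 'a set) \<Rightarrow> (nat \<times> nat \<Rightarrow>\<^sub>0 nat)" where
  "hibi_exponent r n p I =
     (\<Sum>k\<in>{1..r}. \<Sum>l\<in>{l\<in>{1..n}. p l \<in> I k - I (k - 1)}. Poly_Mapping.single (k, l) 1)"

definition word_exponent ::
  "nat \<Rightarrow> nat \<Rightarrow> (nat \<Rightarrow> 'a) \<Rightarrow> (nat \<Rightarrow> 'a set) list \<Rightarrow> (nat \<times> nat \<Rightarrow>\<^sub>0 nat)" where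
  "word_exponent r n p w = sum_list (map (hibi_exponent r n p) w)"

lemma prod_single_one:
  "(\<Prod>i\<in>A. Poly_Mapping.single (e i) (1::'k::field)) = Poly_Mapping.single (\<Sum>i\<in>A. e i) 1"
  for e :: "'i \<Rightarrow> (nat \<times> nat \<Rightarrow>\<^sub>0 nat)"
  by (induction A rule: infinite_finite_induct) (simp_all add: mult_single)

lemma hibi_monomial_eq_single:
  "hibi_monomial r n p I = Poly_Mapping.single (hibi_exponent r n p I) (1::'k::field)"
  by (simp add: hibi_monomial_def hibi_exponent_def xvar_def prod_single_one)

lemma word_monomial_eq_single:
  "word_monomial (hibi_monomial r n p) w
     = Poly_Mapping.single (word_exponent r n p w) (1::'k::field)"
  by (induction w)
    (simp_all add: word_monomial_def word_exponent_def hibi_monomial_eq_single mult_single)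

lemma lookup_hibi_exponent:
  "Poly_Mapping.lookup (hibi_exponent r n p I) (k, l)
     = (if k \<in> {1..r} \<and> l \<in> {1..n} \<and> p l \<in> I k - I (k - 1) then 1 else 0)"
proof -
  have "Poly_Mapping.lookup (hibi_exponent r n p I) (k, l)
      = (\<Sum>i\<in>{1..r}. if i = k then
           (\<Sum>j\<in>{l\<in>{1..n}. p l \<in> I i - I (i - 1)}. if j = l then 1 else 0) else 0)"
    unfolding hibi_exponent_def lookup_sum
    by (intro sum.cong) (auto simp: lookup_single when_def intro!: sum.cong)
  then show ?thesis
    by simp
qed

section \<open>Letter counts and increasing words\<close>

text \<open>This is the number \<open>N\<^sub>k(x)\<close>.\<close>

definition letter_count :: "(nat \<Rightarrow> 'a set) list \<Rightarrow> nat \<Rightarrow> 'a \<Rightarrow> nat" where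
  "letter_count w k x = length (filter (\<lambda>I. x \<in> I k) w)"

lemma letter_count_simps [simp]:
  "letter_count [] k x = 0"
  "letter_count (I # w) k x = (if x \<in> I k then 1 else 0) + letter_count w k x"
  by (simp_all add: letter_count_def)

lemma letter_count_le_length: "letter_count w k x \<le> length w"
  by (simp add: letter_count_def)

text \<open>Point and level vary together, so that one lemma serves both the ideal condition and the
  chain condition.\<close>

lemma letter_count_mono:
  assumes "\<And>I. I \<in> set w \<Longrightarrow> x \<in> I k \<Longrightarrow> y \<in> I j"
  shows "letter_count w k x \<le> letter_count w j y"
  using assms by (induction w) fastforce+

lemma letter_count_eq_length_iff:
  "letter_count w k x = length w \<longleftrightarrow> (\<forall>I\<in>set w. x \<in> I k)"
proof (induction w)
  case (Cons I w)
  then show ?case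
    using letter_count_le_length[of w k x] by auto
qed simp

lemma mem_nth_sorted_iff:
  assumes "sorted_wrt (\<le>) w" "a < length w"
  shows "x \<in> (w ! a) k \<longleftrightarrow> length w - a \<le> letter_count w k x"
  using assms
proof (induction w arbitrary: a)
  case Nil
  then show ?case by simp
next
  case (Cons I w)
  \<comment> \<open>If the first letter has \<open>x\<close> at level \<open>k\<close>, so do all
    later ones, since they are larger.\<close>
  have full: "letter_count w k x = length w" if "x \<in> I k"
    using that Cons.prems(1) by (auto simp: letter_count_eq_length_iff le_fun_def)
  show ?case
  proof (cases a)
    case 0
    then show ?thesis
      using full letter_count_le_length[of w k x] by auto
  next
    case (Suc b)
    then have "x \<in> (w ! b) k \<longleftrightarrow> length w - b \<le> letter_count w k x"
      using Cons by simp
    then show ?thesis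
      using Suc full by auto
  qed
qed

section \<open>Multichains at all levels\<close>

lemma multichain_mono:
  assumes "I \<in> multichains r P"
  shows "I k \<subseteq> I (Suc k)"
proof -
  consider "k = 0" | "k \<in> {1..<r}" | "k = r" | "k > r"
    by force
  then show ?thesis
    using assms by cases (auto simp: multichains_def)
qed

lemma multichain_subset:
  assumes "I \<in> multichains r P"
  shows "I k \<subseteq> P"
proof -
  consider "k = 0" | "k \<in> {1..r}" | "k > r"
    by force
  then show ?thesis
    using assms by cases (auto simp: multichains_def order_ideal_def)
qed

lemma multichain_beyond: "I \<in> multichains r P \<Longrightarrow> k \<ge> r \<Longrightarrow> I k = P"
  by (cases "k = r") (auto simp: multichains_def)

lemma multichain_0: "I \<in> multichains r P \<Longrightarrow> I 0 = {}"
  by (simp add: multichains_def)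

lemma multichain_down:
  "I \<in> multichains r P \<Longrightarrow> x \<in> I k \<Longrightarrow> y \<in> P \<Longrightarrow> y \<le> x \<Longrightarrow> y \<in> I k"
  by (cases "k = 0"; cases "k \<le> r") (auto simp: multichains_def order_ideal_def)

text \<open>Outside the finite index set \<open>{..r}\<close> a multichain has the fixed value
  \<open>P\<close>.\<close>

lemma finite_multichains:
  assumes "finite P"
  shows "finite (multichains r P)"
proof (rule finite_subset)
  show "multichains r P \<subseteq> {I. \<forall>k. (k \<in> {..r} \<longrightarrow> I k \<in> Pow P) \<and> (k \<notin> {..r} \<longrightarrow> I k = P)}"
  proof (intro subsetI CollectI allI conjI impI)
    fix I k assume I: "I \<in> multichains r P"
    show "I k \<in> Pow P"
      using multichain_subset[OF I, of k] by simp
    show "I k = P" if "k \<notin> {..r}"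
      using multichain_beyond[OF I, of k] that by simp
  qed
  show "finite {I. \<forall>k. (k \<in> {..r} \<longrightarrow> I k \<in> Pow P) \<and> (k \<notin> {..r} \<longrightarrow> I k = P)}"
    using assms by (intro finite_set_of_finite_funs finite_atMost) (rule finite_Pow_iff[THEN iffD2])
qed

section \<open>Letter counts and exponents determine each other\<close>

text \<open>Each letter satisfies \<open>I (k - 1) \<subseteq> I k\<close>, so its exponent is the
  difference of the two membership indicators. The additive form avoids truncated
  subtraction.\<close>

lemma letter_count_step:
  assumes "set w \<subseteq> multichains r P" "k \<in> {1..r}" "l \<in> {1..n}"
  shows "letter_count w k (p l) =
    letter_count w (k - 1) (p l) + Poly_Mapping.lookup (word_exponent r n p w) (k, l)"
  using assms(1)
proof (induction w)
  case Nil
  then show ?case by (simp add: word_exponent_def)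
next
  case (Cons I w)
  have "I (k - 1) \<subseteq> I k"
    using multichain_mono[of I r P "k - 1"] Cons.prems assms(2) by simp
  then show ?case
    using Cons assms(2,3) by (auto simp: word_exponent_def lookup_add lookup_hibi_exponent)
qed

lemma letter_count_0:
  "set w \<subseteq> multichains r P \<Longrightarrow> letter_count w 0 x = 0"
  by (induction w) (auto simp: multichain_0)

lemma letter_count_beyond:
  "set w \<subseteq> multichains r P \<Longrightarrow> k \<ge> r \<Longrightarrow> x \<in> P \<Longrightarrow> letter_count w k x = length w"
  unfolding letter_count_eq_length_iff by (metis multichain_beyond subsetD)

lemma lookup_word_exponent_outside:
  "\<not> (k \<in> {1..r} \<and> l \<in> {1..n}) \<Longrightarrow> Poly_Mapping.lookup (word_exponent r n p w) (k, l) = 0"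
  by (induction w) (auto simp: word_exponent_def lookup_add lookup_hibi_exponent)

lemma word_exponent_eqI:
  assumes "set v \<subseteq> multichains r P" "set w \<subseteq> multichains r P" "p ` {1..n} \<subseteq> P"
    and "\<And>k x. x \<in> P \<Longrightarrow> letter_count v k x = letter_count w k x"
  shows "word_exponent r n p v = word_exponent r n p w"
proof (rule poly_mapping_eqI)
  fix kl :: "nat \<times> nat"
  obtain k l where kl: "kl = (k, l)"
    by (cases kl)
  show "Poly_Mapping.lookup (word_exponent r n p v) kl
      = Poly_Mapping.lookup (word_exponent r n p w) kl"
  proof (cases "k \<in> {1..r} \<and> l \<in> {1..n}")
    case True
    then have "p l \<in> P"
      using assms(3) by auto
    then show ?thesis
      using letter_count_step[OF assms(1), of k l n p] letter_count_step[OF assms(2), of k l n p]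
        True assms(4) kl by simp
  qed (simp add: kl lookup_word_exponent_outside)
qed

text \<open>Counts vanish at level 0 and grow by the exponents, which fixes them up to level
  \<open>r\<close>. There every letter equals \<open>P\<close>, so the count at any point of
  \<open>P\<close> is the word length.\<close>

lemma word_exponent_eqD:
  assumes v: "set v \<subseteq> multichains r P" and w: "set w \<subseteq> multichains r P"
    and p: "p ` {1..n} = P" and "P \<noteq> {}"
    and eq: "word_exponent r n p v = word_exponent r n p w"
  shows "length v = length w" and "x \<in> P \<Longrightarrow> letter_count v k x = letter_count w k x"
proof -
  have inner: "letter_count v k x = letter_count w k x" if "k \<le> r" "x \<in> P" for k x
    using that(1)
  proof (induction k)
    case 0
    then show ?case
      by (simp add: letter_count_0[OF v] letter_count_0[OF w])
  next
    case (Suc k)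
    obtain l where "l \<in> {1..n}" "x = p l"
      using \<open>x \<in> P\<close> p by auto
    then show ?case
      using letter_count_step[OF v, of "Suc k" l n p] letter_count_step[OF w, of "Suc k" l n p]
        Suc eq by simp
  qed
  show len: "length v = length w"
  proof -
    obtain y where "y \<in> P"
      using \<open>P \<noteq> {}\<close> by blast
    then show ?thesis
      using inner[of r y] letter_count_beyond[OF v, of r y] letter_count_beyond[OF w, of r y]
      by simp
  qed
  show "letter_count v k x = letter_count w k x" if "x \<in> P"
    using inner[of k x] that letter_count_beyond[OF v, of k x] letter_count_beyond[OF w, of k x] len
    by (cases "k \<le> r") simp_all
qed

lemma inj_on_word_exponent:
  assumes "p ` {1..n} = P" "P \<noteq> {}"
  shows "inj_on (word_exponent r n p) (standard_words (multichains r P))"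
proof
  fix v w
  assume v: "v \<in> standard_words (multichains r P)" and w: "w \<in> standard_words (multichains r P)"
    and eq: "word_exponent r n p v = word_exponent r n p w"
  have sub: "set v \<subseteq> multichains r P" "set w \<subseteq> multichains r P"
    and sorted: "sorted_wrt (\<le>) v" "sorted_wrt (\<le>) w"
    using v w by (simp_all add: standard_words_def)
  note count = word_exponent_eqD[OF sub assms eq]
  show "v = w"
  proof (rule nth_equalityI)
    show "length v = length w"
      by (rule count)
    fix a assume a: "a < length v"
    show "v ! a = w ! a"
    proof (intro ext set_eqI)
      fix k x
      \<comment> \<open>The counts are known to agree only on \<open>P\<close>, so points outside
        \<open>P\<close> must be excluded first.\<close>
      have "(v ! a) k \<subseteq> P" "(w ! a) k \<subseteq> P"
        using sub a count(1) by (metis multichain_subset nth_mem subsetD)+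
      moreover have "x \<in> (v ! a) k \<longleftrightarrow> x \<in> (w ! a) k" if "x \<in> P"
        using sorted a count that by (simp add: mem_nth_sorted_iff)
      ultimately show "x \<in> (v ! a) k \<longleftrightarrow> x \<in> (w ! a) k"
        by blast
    qed
  qed
qed

section \<open>Straightening of words\<close>

text \<open>The letter at position \<open>a\<close> collects the points lying in at least
  \<open>length w - a\<close> of the given ideals: the first letter is their intersection, the last
  their union.\<close>

definition straightened :: "'a set \<Rightarrow> (nat \<Rightarrow> 'a set) list \<Rightarrow> (nat \<Rightarrow> 'a set) list" where
  "straightened P w =
     map (\<lambda>a k. {x\<in>P. length w - a \<le> letter_count w k x}) [0..<length w]"

text \<open>The count decreases along the order of \<open>P\<close> and increases with
  \<open>k\<close>, so its superlevel sets form multichains; lowering the threshold as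
  \<open>a\<close> grows makes the word increasing.\<close>

lemma straightened_standard:
  assumes w: "set w \<subseteq> multichains r P"
  shows "straightened P w \<in> standard_words (multichains r P)"
proof -
  have "(\<lambda>k. {x\<in>P. length w - a \<le> letter_count w k x}) \<in> multichains r P"
    if a: "a < length w" for a
  proof -
    have "letter_count w k x \<le> letter_count w k y" if "y \<le> x" "y \<in> P" for k x y
      using w that by (intro letter_count_mono) (blast intro: multichain_down)
    moreover have "letter_count w k x \<le> letter_count w (Suc k) x" for k x
      using w multichain_mono by (intro letter_count_mono) blast
    \<comment> \<open>Since \<open>a < length w\<close>, the threshold is positive, giving the empty
      set at level 0; it is at most \<open>length w\<close>, giving \<open>P\<close> from level
      \<open>r\<close> on.\<close>
    ultimately show ?thesis
      using a letter_count_0[OF w] letter_count_beyond[OF w]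
      by (fastforce simp: multichains_def order_ideal_def intro: order_trans)
  qed
  moreover have "sorted_wrt (\<le>) (straightened P w)"
    by (auto simp: straightened_def sorted_wrt_iff_nth_less le_fun_def)
  ultimately show ?thesis
    by (auto simp: standard_words_def straightened_def)
qed

lemma letter_count_straightened:
  assumes "x \<in> P"
  shows "letter_count (straightened P w) k x = letter_count w k x"
proof -
  let ?m = "length w" and ?c = "letter_count w k x"
  have "letter_count (straightened P w) k x = card {a. a < ?m \<and> ?m - a \<le> ?c}"
    using assms by (auto simp: letter_count_def straightened_def length_filter_conv_card
        intro!: arg_cong[where f = card])
  \<comment> \<open>The letters containing \<open>x\<close> at level \<open>k\<close> are the last
    \<open>?c\<close> ones.\<close>
  also have "{a. a < ?m \<and> ?m - a \<le> ?c} = {?m - ?c..<?m}"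
    by auto
  finally show ?thesis
    using letter_count_le_length[of w k x] by simp
qed

lemma word_exponent_straightened:
  assumes "set w \<subseteq> multichains r P" "p ` {1..n} \<subseteq> P"
  shows "word_exponent r n p (straightened P w) = word_exponent r n p w"
  using assms straightened_standard[OF assms(1)]
  by (intro word_exponent_eqI) (auto simp: standard_words_def letter_count_straightened)

lemma word_monomials_eq_standard_monomials:
  assumes "p ` {1..n} \<subseteq> P"
  shows "word_monomial (hibi_monomial r n p) ` lists (multichains r P)
    = (word_monomial (hibi_monomial r n p) ` standard_words (multichains r P) :: 'k::field xpoly set)"
proof
  show "word_monomial (hibi_monomial r n p) ` lists (multichains r P)
    \<subseteq> (word_monomial (hibi_monomial r n p) ` standard_words (multichains r P) :: 'k xpoly set)"
  proof (rule image_subsetI)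
    fix w assume "w \<in> lists (multichains r P)"
    then have w: "set w \<subseteq> multichains r P"
      by auto
    show "(word_monomial (hibi_monomial r n p) w :: 'k xpoly)
        \<in> word_monomial (hibi_monomial r n p) ` standard_words (multichains r P)"
      using straightened_standard[OF w] word_exponent_straightened[OF w assms]
      by (intro image_eqI[of _ _ "straightened P w"]) (simp_all add: word_monomial_eq_single)
  qed
qed (auto simp: standard_words_def)

lemma straightening_law:
  assumes p: "p ` {1..n} = P" and "P \<noteq> {}"
    and \<alpha>: "\<alpha> \<in> multichains r P" and \<beta>: "\<beta> \<in> multichains r P"
    and w: "w \<in> standard_words (multichains r P)"
    and eq: "word_exponent r n p w = word_exponent r n p [\<alpha>, \<beta>]"
  shows "w \<noteq> [] \<and> hd w \<le> \<alpha> \<and> hd w \<le> \<beta>"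
proof -
  have sub: "set w \<subseteq> multichains r P" and sorted: "sorted_wrt (\<le>) w"
    using w by (simp_all add: standard_words_def)
  have sub2: "set [\<alpha>, \<beta>] \<subseteq> multichains r P"
    using \<alpha> \<beta> by simp
  note count = word_exponent_eqD[OF sub sub2 p \<open>P \<noteq> {}\<close> eq]
  have nonempty: "w \<noteq> []"
    using count(1) by auto
  have "x \<in> \<alpha> k \<and> x \<in> \<beta> k" if "x \<in> hd w k" for x k
  proof -
    have "x \<in> P"
      using that nonempty sub multichain_subset by (metis hd_in_set subsetD)
    \<comment> \<open>Position 0 has threshold \<open>length w\<close>, which is 2 here, so both
      \<alpha> and \<beta> must contain \<open>x\<close> at level \<open>k\<close>.\<close>
    moreover have "length w \<le> letter_count w k x"
      using that nonempty mem_nth_sorted_iff[OF sorted, of 0 x k] by (simp add: hd_conv_nth)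
    ultimately show ?thesis
      using count by (auto split: if_splits)
  qed
  then show ?thesis
    using nonempty by (auto simp: le_fun_def)
qed

theorem theorem1p31:
  fixes P :: "'a::order set" and p :: "nat \<Rightarrow> 'a" and n r :: nat
  assumes "n \<ge> 1"
    and "bij_betw p {1..n} P"
    and "r \<ge> 1"
  shows "ASL (xscale :: 'k::field \<Rightarrow> 'k xpoly \<Rightarrow> 'k xpoly)
           (hibi_ring r n p P) (multichains r P) (hibi_monomial r n p)"
proof -
  let ?H = "multichains r P" and ?u = "hibi_monomial r n p :: _ \<Rightarrow> 'k xpoly"
  let ?S = "standard_words ?H"
  have p: "p ` {1..n} = P"
    using assms(2) by (simp add: bij_betw_def)
  have P: "finite P" "P \<noteq> {}"
    using p assms(1) by auto
  have inj_exponent: "inj_on (word_exponent r n p) ?S"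
    using p P(2) by (rule inj_on_word_exponent)
  have inj: "inj_on (word_monomial ?u) ?S"
    using inj_exponent by (auto simp: inj_on_def word_monomial_eq_single dest: single_one_eqD)
  show ?thesis
  proof unfold_locales
    show "xpoly.subalgebra (hibi_ring r n p P :: 'k xpoly set)"
      by (simp add: hibi_ring_def xpoly.subalgebra_generated)
    show "finite ?H"
      using P(1) by (rule finite_multichains)
    show "?u ` ?H \<subseteq> hibi_ring r n p P"
      by (simp add: hibi_ring_def xpoly.generated_subalgebra_def hull_subset)
    show "inj_on ?u ?H"
    proof
      fix I J assume "I \<in> ?H" "J \<in> ?H" "?u I = ?u J"
      \<comment> \<open>One-letter words are standard and their monomials are the
        generators.\<close>
      then show "I = J"
        using inj_onD[OF inj, of "[I]" "[J]"] by (simp add: word_monomial_def standard_words_def)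
    qed
    show "inj_on (word_monomial ?u) ?S"
      by (rule inj)
    show "xpoly.independent (word_monomial ?u ` ?S)"
      using independent_monomials[of "word_exponent r n p ` ?S"]
      by (simp add: image_image word_monomial_eq_single)
    show "xpoly.span (word_monomial ?u ` ?S) = hibi_ring r n p P"
      using word_monomials_eq_standard_monomials[of p n P r, where 'k = 'k] p
      by (simp add: hibi_ring_def xpoly.generated_subalgebra_eq_span_words)
    fix \<alpha> \<beta> W c w
    assume \<alpha>: "\<alpha> \<in> ?H" and \<beta>: "\<beta> \<in> ?H"
      and W: "finite W" "W \<subseteq> ?S" "\<forall>v\<in>W. c v \<noteq> 0" "w \<in> W"
      and prod: "?u \<alpha> * ?u \<beta> = (\<Sum>v\<in>W. xscale (c v) (word_monomial ?u v))"
    \<comment> \<open>The left side of \<open>prod\<close> is a single monomial, while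
      \<open>c w\<close> is the coefficient of the right side at the exponent of \<open>w\<close>.
      As \<open>c w\<close> is nonzero, the two exponents coincide.\<close>
    have "inj_on (word_exponent r n p) W"
      using inj_exponent W(2) by (rule inj_on_subset)
    then have "Poly_Mapping.lookup (?u \<alpha> * ?u \<beta>) (word_exponent r n p w) = c w"
      using W by (simp add: prod word_monomial_eq_single lookup_sum_monomials)
    moreover have "?u \<alpha> * ?u \<beta> = Poly_Mapping.single (word_exponent r n p [\<alpha>, \<beta>]) 1"
      by (simp add: word_exponent_def hibi_monomial_eq_single mult_single)
    ultimately have "word_exponent r n p w = word_exponent r n p [\<alpha>, \<beta>]"
      using W by (auto simp: lookup_single when_def split: if_splits)
    then show "w \<noteq> [] \<and> hd w \<le> \<alpha> \<and> hd w \<le> \<beta>"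
      using straightening_law[OF p P(2) \<alpha> \<beta>] W by blast
  qed
qed

end
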